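(* Assume the decomposable structure $f(x;\theta,u)=f_1(x;u)+f_2(\theta;u)+\langle\theta,c(x)\rangle$ and assume there is no noise, i.e. $y_t=x(\theta_{true};u_t)$ for all $t\in[T]$. Assume further that $f$ is a strongly convex function of $x$ for every $\theta$, i.e., there exists $\gamma>0$ such that $$f(x;\theta,u)-f(y;\theta,u)\ \ge\ \langle s_y,x-y\rangle+\frac{\gamma}{2}\|x-y\|^2,$$ where $s_y$ is a subgradient of $f(y;\theta,u)$ with respect to $y$. Then for any sequence $\{\theta_t\}_{t\in[T]}\subseteq\Theta$, $$R_T(\{\ell^{sub}_t\}_{t\in[T]},\{\theta_t\}_{t\in[T]})\ \ge\ \frac{\gamma}{2}\,R_T(\{\ell^{pre}_t\}_{t\in[T]},\{\theta_t\}_{t\in[T]}).$$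
   Context: Let $T\ge 1$, $[T]=\{1,\dots,T\}$, let $\Theta\subseteq\mathbb{R}^p$ be a convex set with $\theta_{true}\in\Theta$, and let $\mathcal{X}\subseteq\mathbb{R}^n$. For a signal $u\in\mathbb{R}^k$, the feasible set of the agent is $\{x\in\mathcal{X}: g(x;u)\le 0\}$, where $g$ is a given (set of) constraint function(s). For $\theta\in\Theta$ and a signal $u$, the agent's problem is to minimize $f(x;\theta,u)$ over this feasible set, and $x(\theta;u)\in\arg\min_x\{f(x;\theta,u): g(x;u)\le 0,\ x\in\mathcal{X}\}$ denotes an optimal solution. Decomposable structure means $f(x;\theta,u)=f_1(x;u)+f_2(\theta;u)+\langle\theta,c(x)\rangle$ with $f_1,f_2$ real valued and $c(x)=(c_1(x),\dots,c_p(x))\in\mathbb{R}^p$; these functions of $x$ are defined on a convex set $D\subseteq\mathbb{R}^n$ containing $\mathcal{X}$, and the strong convexity inequality is for all $x,y\in D$, all $\theta\in\Theta$ and all signals $u$. The norm $\|\cdot\|$ is Euclidean. Signals $u_1,\dots,u_T$ and observations $y_1,\dots,y_T$ are given. For $\theta\in\Theta$: the prediction loss is $\ell^{pre}_t(\theta)=\|y_t-x(\theta;u_t)\|^2$; the suboptimality loss is $\ell^{sub}_t(\theta)=f(y_t;\theta,u_t)-f(x(\theta;u_t);\theta,u_t)$. The regret of a sequence $\{\theta_t\}_{t\in[T]}$ with respect to losses $\{\ell_t\}_{t\in[T]}$ is $R_T(\{\ell_t\}_{t\in[T]},\{\theta_t\}_{t\in[T]})=\sum_{t\in[T]}\ell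_t(\theta_t)-\min_{\theta\in\Theta}\sum_{t\in[T]}\ell_t(\theta)$.
   Formalization: The feasible set {x in X : g(x;u) ≤ 0} is additionally assumed convex for every signal u; without this the claim fails, e.g. X={-1,1}, f=x²+θx, γ=2, θ_true=-1, T=1, θ_1 in (0,1). *)

theory Defs
  imports "HOL-Analysis.Analysis"
begin

text \<open>The family of constraints is indexed by an arbitrary type \<open>'j\<close>, so both a single constraint
  and a system of constraints are covered. Comparing the two losses requires a convex feasible set: over
  \<open>{-1, 1}\<close>, the function \<open>x\<^sup>2\<close> has two distinct minimisers, so the suboptimality loss can be \<open>0\<close>
  while the prediction loss is \<open>4\<close>.\<close>

definition feasible ::
  "(real^'n) set \<Rightarrow> ('j \<Rightarrow> real^'n \<Rightarrow> 'u \<Rightarrow> real) \<Rightarrow> 'u \<Rightarrow> (real^'n) set" where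
  "feasible X g u = {x \<in> X. \<forall>j. g j x u \<le> 0}"

definition optimal_solution ::
  "(real^'n) set \<Rightarrow> ('j \<Rightarrow> real^'n \<Rightarrow> 'u \<Rightarrow> real) \<Rightarrow> (real^'n \<Rightarrow> 'p \<Rightarrow> 'u \<Rightarrow> real) \<Rightarrow>
    'p \<Rightarrow> 'u \<Rightarrow> real^'n \<Rightarrow> bool" where
  "optimal_solution X g f \<theta> u x \<longleftrightarrow> is_arg_min (\<lambda>z. f z \<theta> u) (\<lambda>z. z \<in> feasible X g u) x"

text \<open>Functions of \<open>x\<close> are only considered on a set \<open>D\<close>; values outside \<open>D\<close> play no role, so
  subgradients are taken relative to \<open>D\<close>.\<close>

definition subdifferential_on :: "(real^'n) set \<Rightarrow> (real^'n \<Rightarrow> real) \<Rightarrow> real^'n \<Rightarrow> (real^'n) set" where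
  "subdifferential_on D F y = {s. \<forall>x\<in>D. F x \<ge> F y + s \<bullet> (x - y)}"

text \<open>Every point of \<open>D\<close> is required to have a subgradient \<open>s\<close> satisfying the inequality. On a convex
  \<open>D\<close>, with \<open>\<gamma> > 0\<close>, it then holds for every subgradient at that point. Requiring it for
  every subgradient without existence would be vacuous wherever the subdifferential is empty.\<close>

definition strongly_convex_on :: "(real^'n) set \<Rightarrow> real \<Rightarrow> (real^'n \<Rightarrow> real) \<Rightarrow> bool" where
  "strongly_convex_on D \<gamma> F \<longleftrightarrow>
    (\<forall>y\<in>D. \<exists>s\<in>subdifferential_on D F y. \<forall>x\<in>D.
      F x - F y \<ge> s \<bullet> (x - y) + \<gamma> / 2 * (norm (x - y))\<^sup>2)"

text \<open>In the losses, \<open>xs \<theta> u\<close> is the chosen optimal solution, \<open>u t\<close> the signal and \<open>y t\<close> the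
  observation at time \<open>t\<close>.\<close>

definition loss_pre ::
  "('p \<Rightarrow> 'u \<Rightarrow> real^'n) \<Rightarrow> (nat \<Rightarrow> 'u) \<Rightarrow> (nat \<Rightarrow> real^'n) \<Rightarrow> nat \<Rightarrow> 'p \<Rightarrow> real" where
  "loss_pre xs u y t \<theta> = (norm (y t - xs \<theta> (u t)))\<^sup>2"

definition loss_sub ::
  "(real^'n \<Rightarrow> 'p \<Rightarrow> 'u \<Rightarrow> real) \<Rightarrow> ('p \<Rightarrow> 'u \<Rightarrow> real^'n) \<Rightarrow> (nat \<Rightarrow> 'u) \<Rightarrow> (nat \<Rightarrow> real^'n) \<Rightarrow>
    nat \<Rightarrow> 'p \<Rightarrow> real" where
  "loss_sub f xs u y t \<theta> = f (y t) \<theta> (u t) - f (xs \<theta> (u t)) \<theta> (u t)"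

text \<open>The minimum is over a possibly infinite set, so \<open>Min\<close> does not apply; \<open>LEAST\<close> is the
  attained minimum, whenever there is one.\<close>

definition regret :: "'p set \<Rightarrow> nat \<Rightarrow> (nat \<Rightarrow> 'p \<Rightarrow> real) \<Rightarrow> (nat \<Rightarrow> 'p) \<Rightarrow> real" where
  "regret \<Theta> T l \<theta>s =
    (\<Sum>t=1..T. l t (\<theta>s t)) - (LEAST v. v \<in> (\<lambda>\<theta>. \<Sum>t=1..T. l t \<theta>) ` \<Theta>)"

end

theory Submission
  imports Defs
begin

text \<open>A strongly convex function grows at least quadratically away from its minimiser over a convex
  set (\<open>quadratic_growth_at_minimiser\<close>). Without noise the observation \<open>y t\<close> is itself feasible for
  the problem whose optimal solution is \<open>xs \<theta> (u t)\<close>, so quadratic growth bounds \<open>\<gamma> / 2\<close> times the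
  prediction loss by the suboptimality loss, pointwise in \<open>t\<close> and \<open>\<theta>\<close>.

  This settles the sums over the iterates. The subtracted minima could spoil such a comparison, but here
  both are zero: both losses are nonnegative, and both vanish at the true parameter, which explains every
  observation exactly. Hence each regret is just its cumulative loss (\<open>regret_eq_cumulative_loss\<close>), and
  summing the pointwise bound gives the claim.\<close>

text \<open>Strong convexity in its derivative-free form. The subgradient is taken at the intermediate point
  \<open>w\<close>, and its inequality is used towards both endpoints; in the convex combination the linear terms
  cancel, because the weighted displacements from \<open>w\<close> add up to zero. Taking the subgradient at an
  endpoint, for instance a constrained minimiser, would tell less: the subgradient supplied there
  need not have nonnegative inner product with the feasible directions.\<close>

lemma strongly_convex_on_segment:
  fixes F :: "real^'n \<Rightarrow> real"
  assumes sc: "strongly_convex_on D \<gamma> F" and "x \<in> D" "z \<in> D"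
    and r: "0 \<le> r" "r \<le> 1" and w: "r *\<^sub>R x + (1 - r) *\<^sub>R z \<in> D"
  shows "F (r *\<^sub>R x + (1 - r) *\<^sub>R z) + \<gamma> / 2 * (r * (1 - r) * (norm (z - x))\<^sup>2)
    \<le> r * F x + (1 - r) * F z"
proof -
  define w where "w = r *\<^sub>R x + (1 - r) *\<^sub>R z"
  obtain s where s: "\<And>v. v \<in> D \<Longrightarrow> F v - F w \<ge> s \<bullet> (v - w) + \<gamma> / 2 * (norm (v - w))\<^sup>2"
    using sc w unfolding strongly_convex_on_def w_def by blast
  have xw: "x - w = (r - 1) *\<^sub>R (z - x)" and zw: "z - w = r *\<^sub>R (z - x)"
    by (simp_all add: w_def algebra_simps)
  define a where "a = s \<bullet> (z - x)"
  define q where "q = (norm (z - x))\<^sup>2"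
  have "F w + (r - 1) * a + \<gamma> / 2 * ((r - 1)\<^sup>2 * q) \<le> F x"
    using s[OF \<open>x \<in> D\<close>] by (simp add: xw a_def q_def power_mult_distrib)
  then have "r * (F w + (r - 1) * a + \<gamma> / 2 * ((r - 1)\<^sup>2 * q)) \<le> r * F x"
    using r by (intro mult_left_mono)
  moreover have "F w + r * a + \<gamma> / 2 * (r\<^sup>2 * q) \<le> F z"
    using s[OF \<open>z \<in> D\<close>] by (simp add: zw a_def q_def power_mult_distrib)
  then have "(1 - r) * (F w + r * a + \<gamma> / 2 * (r\<^sup>2 * q)) \<le> (1 - r) * F z"
    using r by (intro mult_left_mono) auto
  moreover have "r * (F w + (r - 1) * a + \<gamma> / 2 * ((r - 1)\<^sup>2 * q))
      + (1 - r) * (F w + r * a + \<gamma> / 2 * (r\<^sup>2 * q)) = F w + \<gamma> / 2 * (r * (1 - r) * q)"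
    by (simp add: field_simps power2_eq_square)
  ultimately show ?thesis
    unfolding w_def[symmetric] q_def[symmetric] by linarith
qed

text \<open>Moving from the minimiser \<open>x\<close> a short way towards \<open>z\<close> stays in the convex set \<open>C\<close> and so cannot
  decrease \<open>F\<close>. Inserting this in the segment inequality and dividing by the step length \<open>1 - r\<close> gives the
  bound up to the factor \<open>r\<close>, which can be taken arbitrarily close to 1; thus the constant \<open>\<gamma> / 2\<close> is not
  degraded.\<close>

lemma quadratic_growth_at_minimiser:
  fixes F :: "real^'n \<Rightarrow> real"
  assumes sc: "strongly_convex_on D \<gamma> F" and "convex C" "C \<subseteq> D"
    and min: "is_arg_min F (\<lambda>v. v \<in> C) x" and "z \<in> C"
  shows "\<gamma> / 2 * (norm (z - x))\<^sup>2 \<le> F z - F x"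
proof (rule field_le_mult_one_interval)
  fix r :: real
  assume r: "0 < r" "r < 1"
  have "x \<in> C"
    using min by (simp add: is_arg_min_def)
  then have w: "r *\<^sub>R x + (1 - r) *\<^sub>R z \<in> C"
    using \<open>convex C\<close> \<open>z \<in> C\<close> r by (simp add: convexD)
  then have "F x \<le> F (r *\<^sub>R x + (1 - r) *\<^sub>R z)"
    using min by (auto simp: is_arg_min_def not_less)
  also have "\<dots> \<le> r * F x + (1 - r) * F z - \<gamma> / 2 * (r * (1 - r) * (norm (z - x))\<^sup>2)"
    using strongly_convex_on_segment[OF sc, of x z r] \<open>x \<in> C\<close> \<open>z \<in> C\<close> w r \<open>C \<subseteq> D\<close>
    by (simp add: subsetD le_diff_eq)
  finally have "(1 - r) * (r * (\<gamma> / 2 * (norm (z - x))\<^sup>2)) \<le> (1 - r) * (F z - F x)"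
    by (simp add: field_simps)
  then show "r * (\<gamma> / 2 * (norm (z - x))\<^sup>2) \<le> F z - F x"
    using r by simp
qed

text \<open>The realisable case: a comparator that incurs no loss in any round attains the minimum in the
  regret, and in particular turns the \<open>LEAST\<close> there into an attained value.\<close>

lemma regret_eq_cumulative_loss:
  assumes "\<theta>\<^sub>0 \<in> \<Theta>" and zero: "\<And>t. t \<in> {1..T} \<Longrightarrow> l t \<theta>\<^sub>0 = 0"
    and nonneg: "\<And>t \<theta>. t \<in> {1..T} \<Longrightarrow> \<theta> \<in> \<Theta> \<Longrightarrow> 0 \<le> l t \<theta>"
  shows "regret \<Theta> T l \<theta>s = (\<Sum>t=1..T. l t (\<theta>s t))"
proof -
  have "(LEAST v. v \<in> (\<lambda>\<theta>. \<Sum>t=1..T. l t \<theta>) ` \<Theta>) = 0"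
  proof (rule Least_equality)
    have "(\<Sum>t=1..T. l t \<theta>\<^sub>0) = 0"
      using zero by (intro sum.neutral) auto
    then show "0 \<in> (\<lambda>\<theta>. \<Sum>t=1..T. l t \<theta>) ` \<Theta>"
      using \<open>\<theta>\<^sub>0 \<in> \<Theta>\<close> by force
  qed (use nonneg in \<open>auto intro: sum_nonneg\<close>)
  then show ?thesis
    by (simp add: regret_def)
qed

theorem corollary1:
  fixes T :: nat
    and \<Theta> :: "(real^'p) set" and \<theta>_true :: "real^'p"
    and X D :: "(real^'n) set"
    and U :: "(real^'k) set"
    and g :: "'j \<Rightarrow> real^'n \<Rightarrow> real^'k \<Rightarrow> real"
    and f :: "real^'n \<Rightarrow> real^'p \<Rightarrow> real^'k \<Rightarrow> real"
    and f1 :: "real^'n \<Rightarrow> real^'k \<Rightarrow> real" and f2 :: "real^'p \<Rightarrow> real^'k \<Rightarrow> real"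
    and c :: "real^'n \<Rightarrow> real^'p"
    and xs :: "real^'p \<Rightarrow> real^'k \<Rightarrow> real^'n"
    and u :: "nat \<Rightarrow> real^'k" and y :: "nat \<Rightarrow> real^'n"
    and \<theta>s :: "nat \<Rightarrow> real^'p"
    and \<gamma> :: real
  assumes "T \<ge> 1"
    and "convex \<Theta>" and "\<theta>_true \<in> \<Theta>"
    and "convex D" and "X \<subseteq> D"
    and "\<forall>u\<in>U. convex (feasible X g u)"
    and "\<forall>\<theta>\<in>\<Theta>. \<forall>u\<in>U. optimal_solution X g f \<theta> u (xs \<theta> u)"
    and "\<forall>x\<in>D. \<forall>\<theta>\<in>\<Theta>. \<forall>u\<in>U. f x \<theta> u = f1 x u + f2 \<theta> u + \<theta> \<bullet> c x"
    and "\<gamma> > 0"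
    and "\<forall>\<theta>\<in>\<Theta>. \<forall>u\<in>U. strongly_convex_on D \<gamma> (\<lambda>x. f x \<theta> u)"
    and "\<forall>t\<in>{1..T}. u t \<in> U"
    and "\<forall>t\<in>{1..T}. y t = xs \<theta>_true (u t)"
    and "\<forall>t\<in>{1..T}. \<theta>s t \<in> \<Theta>"
  shows "regret \<Theta> T (loss_sub f xs u y) \<theta>s \<ge> \<gamma> / 2 * regret \<Theta> T (loss_pre xs u y) \<theta>s"
proof -
  have opt: "is_arg_min (\<lambda>x. f x \<theta> (u t)) (\<lambda>x. x \<in> feasible X g (u t)) (xs \<theta> (u t))"
    if "t \<in> {1..T}" "\<theta> \<in> \<Theta>" for t \<theta>
    using assms that by (simp add: optimal_solution_def)
  have bound: "\<gamma> / 2 * loss_pre xs u y t \<theta> \<le> loss_sub f xs u y t \<theta>"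
    if t: "t \<in> {1..T}" and \<theta>: "\<theta> \<in> \<Theta>" for t \<theta>
  proof -
    \<comment> \<open>The feasible set depends on the signal only, so the optimum for \<open>\<theta>_true\<close> competes in the
      problem for \<open>\<theta>\<close>.\<close>
    have "y t \<in> feasible X g (u t)"
      using opt[OF t \<open>\<theta>_true \<in> \<Theta>\<close>] assms t by (simp add: is_arg_min_def)
    moreover have "feasible X g (u t) \<subseteq> D"
      using \<open>X \<subseteq> D\<close> by (auto simp: feasible_def)
    ultimately show ?thesis
      unfolding loss_pre_def loss_sub_def using assms t \<theta>
      by (intro quadratic_growth_at_minimiser[OF _ _ _ opt]) auto
  qed
  have pre: "regret \<Theta> T (loss_pre xs u y) \<theta>s = (\<Sum>t=1..T. loss_pre xs u y t (\<theta>s t))"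
    using assms by (intro regret_eq_cumulative_loss[of \<theta>_true]) (auto simp: loss_pre_def)
  have "0 \<le> loss_sub f xs u y t \<theta>" if "t \<in> {1..T}" "\<theta> \<in> \<Theta>" for t \<theta>
  proof -
    have "0 \<le> \<gamma> / 2 * loss_pre xs u y t \<theta>"
      using \<open>\<gamma> > 0\<close> by (simp add: loss_pre_def)
    then show ?thesis
      using bound[OF that] by linarith
  qed
  then have sub: "regret \<Theta> T (loss_sub f xs u y) \<theta>s = (\<Sum>t=1..T. loss_sub f xs u y t (\<theta>s t))"
    using assms by (intro regret_eq_cumulative_loss[of \<theta>_true]) (auto simp: loss_sub_def)
  show ?thesis
    unfolding pre sub sum_distrib_left using bound assms by (intro sum_mono) auto
qed

end
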